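(* Fix any $\delta>0$. For a finite graph $G=(V,E)$ let ${\rm sd}(G)$ be the optimal value (infimum) of the following problem over families of vectors $\{{\bf v}_i : i\in\{0\}\cup V\}\subseteq\mathbb{R}^m$ ($m$ arbitrary): $$\text{minimize } \sum_{i\in V}\Big(1-\tfrac{\|{\bf v}_0-{\bf v}_i\|^2}{4}\Big)$$ subject to $\|{\bf v}_i-{\bf v}_0\|^2+\|{\bf v}_j-{\bf v}_0\|^2=\|{\bf v}_i-{\bf v}_j\|^2$ for every edge $ij\in E$; $\|{\bf v}_i\|=1$ for every $i\in\{0\}\cup V$; and $c_1(\{{\bf v}_i:i\in\{0\}\cup V\},\|\cdot\|^2)\le 1+\delta$. Then for every $\epsilon>0$ there is a finite graph $G$ such that $\frac{{\rm vc}(G)}{{\rm sd}(G)}\ge 2-\epsilon$, where ${\rm vc}(G)$ is the size of a minimum vertex cover of $G$.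
   Context: $\|\cdot\|$ is the Euclidean norm. For a finite set $X$ with a distance function $d$ (here $d(x,y)=\|x-y\|^2$), $c_1(X,d)$ is the minimum distortion of an embedding into $\ell_1$: the infimum of $D\ge 1$ such that for some $M$, some $\phi:X\to\mathbb{R}^M$ and some $\gamma>0$, $\gamma\, d(a,b)\le \|\phi(a)-\phi(b)\|_1\le \gamma D\, d(a,b)$ for all $a,b\in X$. *)

theory Defs
  imports "HOL-Analysis.Analysis" "HOL-Library.Ramsey"
begin

text \<open>A finite simple graph is given by its vertex set and its set of edges, which are
  two-element sets of vertices.\<close>

definition finite_graph :: "'a set \<Rightarrow> 'a set set \<Rightarrow> bool" where
  "finite_graph V E \<longleftrightarrow> finite V \<and> E \<subseteq> nsets V 2"

definition vertex_cover :: "'a set \<Rightarrow> 'a set set \<Rightarrow> 'a set \<Rightarrow> bool" where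
  "vertex_cover V E C \<longleftrightarrow> C \<subseteq> V \<and> (\<forall>e\<in>E. e \<inter> C \<noteq> {})"

definition vc :: "'a set \<Rightarrow> 'a set set \<Rightarrow> nat" where
  "vc V E = Min (card ` {C. vertex_cover V E C})"

text \<open>As the dimension \<open>m\<close> varies inside the optimization problem, \<open>\<real>\<^sup>m\<close> is the set of
  functions on \<open>{..<m}\<close>, made extensional so that points with equal coordinates are equal.\<close>

definition Rvec :: "nat \<Rightarrow> (nat \<Rightarrow> real) set" where
  "Rvec m = {..<m} \<rightarrow>\<^sub>E UNIV"

definition vnorm :: "nat \<Rightarrow> (nat \<Rightarrow> real) \<Rightarrow> real" where
  "vnorm m x = L2_set x {..<m}"

definition sqdist :: "nat \<Rightarrow> (nat \<Rightarrow> real) \<Rightarrow> (nat \<Rightarrow> real) \<Rightarrow> real" where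
  "sqdist m x y = (vnorm m (\<lambda>k. x k - y k))\<^sup>2"

definition l1_dist :: "nat \<Rightarrow> (nat \<Rightarrow> real) \<Rightarrow> (nat \<Rightarrow> real) \<Rightarrow> real" where
  "l1_dist M x y = (\<Sum>k<M. \<bar>x k - y k\<bar>)"

definition embeds_l1 :: "'b set \<Rightarrow> ('b \<Rightarrow> 'b \<Rightarrow> real) \<Rightarrow> real \<Rightarrow> bool" where
  "embeds_l1 X d D \<longleftrightarrow>
     (\<exists>M. \<exists>\<phi> :: 'b \<Rightarrow> nat \<Rightarrow> real. \<exists>\<gamma>>0. \<phi> \<in> X \<rightarrow> Rvec M \<and>
        (\<forall>a\<in>X. \<forall>b\<in>X. \<gamma> * d a b \<le> l1_dist M (\<phi> a) (\<phi> b) \<and>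
                       l1_dist M (\<phi> a) (\<phi> b) \<le> \<gamma> * D * d a b))"

text \<open>The set under the infimum is nonempty whenever \<open>X\<close> is finite and \<open>d\<close> vanishes exactly
  on the diagonal and is positive off it (send the points to distinct unit vectors).\<close>

definition c1 :: "'b set \<Rightarrow> ('b \<Rightarrow> 'b \<Rightarrow> real) \<Rightarrow> real" where
  "c1 X d = Inf {D. D \<ge> 1 \<and> embeds_l1 X d D}"

text \<open>The vector with index \<open>0\<close>, which is not a vertex, is the separate argument \<open>v0\<close>.\<close>

definition sd_feasible ::
  "real \<Rightarrow> 'a set \<Rightarrow> 'a set set \<Rightarrow> nat \<Rightarrow> (nat \<Rightarrow> real) \<Rightarrow> ('a \<Rightarrow> nat \<Rightarrow> real) \<Rightarrow> bool" where
  "sd_feasible \<delta> V E m v0 v \<longleftrightarrow>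
     v0 \<in> Rvec m \<and> (\<forall>i\<in>V. v i \<in> Rvec m) \<and>
     (\<forall>i j. {i, j} \<in> E \<longrightarrow> sqdist m (v i) v0 + sqdist m (v j) v0 = sqdist m (v i) (v j)) \<and>
     vnorm m v0 = 1 \<and> (\<forall>i\<in>V. vnorm m (v i) = 1) \<and>
     c1 (insert v0 (v ` V)) (sqdist m) \<le> 1 + \<delta>"

text \<open>The infimum is over a nonempty set of nonnegative reals: all vectors equal to one unit
  vector is feasible, and unit vectors are at squared distance at most 4.\<close>

definition sd :: "real \<Rightarrow> 'a set \<Rightarrow> 'a set set \<Rightarrow> real" where
  "sd \<delta> V E = Inf {(\<Sum>i\<in>V. 1 - sqdist m v0 (v i) / 4) | m v0 v. sd_feasible \<delta> V E m v0 v}"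

end

theory Submission
  imports Defs "HOL-Computational_Algebra.Primes"
begin

text \<open>
  The vertices are the \<open>k\<close>-subsets of a set of size \<open>2 k\<close>, where \<open>k = p + t\<close> for a large prime
  \<open>p\<close> and \<open>\<xi> = t / p\<close> is small, and two of them are joined when they meet in exactly \<open>t\<close>
  points. By the modular Frankl-Wilson theorem an independent set has at most as many members as
  there are sets of size less than \<open>p\<close>, a vanishing proportion of all vertices, so almost all
  vertices are needed in a cover. In the vector program, take \<open>v\<^sub>0\<close> to be the last unit vector,
  and for a vertex \<open>A\<close> the scaled \<open>\<plusminus>1\<close> indicator vector of \<open>A\<close> with last coordinate \<open>\<xi>\<close>. The
  value \<open>\<xi> = t / p\<close> is exactly what the edge constraints require. Each vertex then costs
  \<open>(1 + \<xi>) / 2\<close>. Squared Euclidean distance on the cube is a multiple of the \<open>l\<^sub>1\<close> distance, so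
  only the distances to \<open>v\<^sub>0\<close> are distorted, by the factor \<open>1 + \<xi>\<close>.
\<close>

section \<open>Linear relations modulo p and the Frankl-Wilson bound\<close>

text \<open>Pigeonhole instead of linear algebra: there are \<open>p ^ card X\<close> coefficient
  families with entries in \<open>{0..<p}\<close> but only \<open>p ^ card S\<close> possible tuples
  of residues, so two distinct families collide, and their difference is the solution.\<close>

lemma congruence_system_nontrivial_solution:
  fixes a :: "'e \<Rightarrow> 'x \<Rightarrow> int" and p :: nat
  assumes "finite S" "finite X" "card S < card X" "p \<ge> 2"
  shows "\<exists>c. (\<exists>x\<in>X. \<not> int p dvd c x) \<and> (\<forall>e\<in>S. int p dvd (\<Sum>x\<in>X. c x * a e x))"
proof -
  define R where "R = {0..<int p}"
  define G where "G g = (\<lambda>e\<in>S. (\<Sum>x\<in>X. g x * a e x) mod int p)" for g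
  have img: "G ` (X \<rightarrow>\<^sub>E R) \<subseteq> S \<rightarrow>\<^sub>E R"
    using assms(4) by (auto simp: G_def R_def)
  have fin: "finite (X \<rightarrow>\<^sub>E R)" "finite (S \<rightarrow>\<^sub>E R)"
    using assms by (auto intro: finite_PiE simp: R_def)
  have "card (S \<rightarrow>\<^sub>E R) < card (X \<rightarrow>\<^sub>E R)"
    using assms by (simp add: card_PiE R_def)
  then have "\<not> inj_on G (X \<rightarrow>\<^sub>E R)"
    using card_inj_on_le[OF _ img fin(2)] by linarith
  then obtain g g' where g: "g \<in> X \<rightarrow>\<^sub>E R" "g' \<in> X \<rightarrow>\<^sub>E R" "g \<noteq> g'" "G g = G g'"
    by (auto simp: inj_on_def)
  obtain x where x: "x \<in> X" "g x \<noteq> g' x"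
    using g(1-3) by (meson PiE_ext)
  have "g x \<in> R" "g' x \<in> R"
    using g x by auto
  then have "\<not> int p dvd g x - g' x"
    using x(2) unfolding R_def
    by (metis atLeastLessThan_iff mod_eq_dvd_iff mod_pos_pos_trivial)
  moreover have "int p dvd (\<Sum>x\<in>X. (g x - g' x) * a e x)" if "e \<in> S" for e
  proof -
    have "(\<Sum>x\<in>X. g x * a e x) mod int p = (\<Sum>x\<in>X. g' x * a e x) mod int p"
      using fun_cong[OF g(4), of e] that by (simp add: G_def)
    then show ?thesis
      by (simp add: mod_eq_dvd_iff left_diff_distrib sum_subtractf)
  qed
  ultimately show ?thesis
    using x(1) by (intro exI[of _ "\<lambda>x. g x - g' x"]) auto
qed

text \<open>A nontrivial relation modulo \<open>p\<close> among the vectors \<open>([T \<subseteq> A])\<^sub>T\<close>, \<open>card T < p\<close>, annihilates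
  every polynomial of degree less than \<open>p\<close> in \<open>card (A \<inter> B)\<close>. The polynomial used here vanishes
  modulo \<open>p\<close> except where \<open>card (A \<inter> B)\<close> is \<open>k\<close> or \<open>t\<close>, so it isolates the term \<open>A = B\<close>.\<close>

lemma frankl_wilson:
  fixes p t k :: nat and F :: "'a set set"
  assumes p: "prime p" and "t < p" and k: "k = p + t" and U: "finite U"
    and F: "\<And>A. A \<in> F \<Longrightarrow> A \<subseteq> U \<and> card A = k"
    and avoid: "\<And>A B. A \<in> F \<Longrightarrow> B \<in> F \<Longrightarrow> A \<noteq> B \<Longrightarrow> card (A \<inter> B) \<noteq> t"
  shows "card F \<le> card {S. S \<subseteq> U \<and> card S < p}"
proof (rule ccontr)
  assume "\<not> ?thesis"
  moreover have finF: "finite F"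
    using finite_subset[of F "Pow U"] F U by auto
  ultimately obtain c :: "'a set \<Rightarrow> int" and B where c: "B \<in> F" "\<not> int p dvd c B"
    and c0: "\<And>T. T \<subseteq> U \<Longrightarrow> card T < p \<Longrightarrow> int p dvd (\<Sum>A\<in>F. c A * of_bool (T \<subseteq> A))"
    using congruence_system_nontrivial_solution
      [of "{S. S \<subseteq> U \<and> card S < p}" F p "\<lambda>T A. of_bool (T \<subseteq> A)"] U prime_ge_2_nat[OF p]
    by auto
  have BU: "B \<subseteq> U" "finite B" and cB: "card B = k"
    using F[OF c(1)] U finite_subset by auto
  define P where "P j A = (\<Prod>l=1..j. int (card (A \<inter> B)) - int t - int l)" for j A
  \<comment> \<open>Multiplying by \<open>card (A \<inter> B)\<close>, the sum over \<open>b\<close>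
    in \<open>B\<close> of \<open>[b \<in> A]\<close>, turns \<open>[T \<subseteq> A]\<close> into a
    sum of \<open>[insert b T \<subseteq> A]\<close>. Each further factor of \<open>P\<close> thus
    enlarges \<open>T\<close> by at most one point; starting from the empty set,
    \<open>p - 1\<close> factors can be reached.\<close>
  have step: "int p dvd (\<Sum>A\<in>F. c A * of_bool (T \<subseteq> A) * P j A)"
    if "T \<subseteq> U" "card T + j < p" for T j
    using that
  proof (induction j arbitrary: T)
    case 0
    then show ?case using c0 by (simp add: P_def)
  next
    case (Suc j)
    have "(\<Sum>A\<in>F. c A * of_bool (T \<subseteq> A) * P (Suc j) A) =
        (\<Sum>A\<in>F. \<Sum>b\<in>B. c A * of_bool (insert b T \<subseteq> A) * P j A)
        - (int t + int (Suc j)) * (\<Sum>A\<in>F. c A * of_bool (T \<subseteq> A) * P j A)"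
      unfolding sum_distrib_left sum_subtractf[symmetric]
    proof (rule sum.cong[OF refl])
      fix A
      have "int (card (A \<inter> B)) = (\<Sum>b\<in>B. of_bool (b \<in> A))"
        using BU by (simp add: Int_commute)
      then have 1: "(\<Sum>b\<in>B. c A * of_bool (insert b T \<subseteq> A) * P j A)
          = c A * of_bool (T \<subseteq> A) * P j A * int (card (A \<inter> B))"
        by (simp add: sum_distrib_left of_bool_conj mult_ac)
      have 2: "P (Suc j) A = P j A * (int (card (A \<inter> B)) - (int t + int (Suc j)))"
        by (simp add: P_def algebra_simps)
      show "c A * of_bool (T \<subseteq> A) * P (Suc j) A =
          (\<Sum>b\<in>B. c A * of_bool (insert b T \<subseteq> A) * P j A)
          - (int t + int (Suc j)) * (c A * of_bool (T \<subseteq> A) * P j A)"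
        unfolding 1 2 by (simp only: right_diff_distrib mult_ac)
    qed
    moreover have "int p dvd (\<Sum>A\<in>F. \<Sum>b\<in>B. c A * of_bool (insert b T \<subseteq> A) * P j A)"
    proof (subst sum.swap, rule dvd_sum)
      fix b assume "b \<in> B"
      moreover have "card (insert b T) \<le> Suc (card T)"
        by (rule card_insert_le_m1) auto
      ultimately show "int p dvd (\<Sum>A\<in>F. c A * of_bool (insert b T \<subseteq> A) * P j A)"
        using Suc BU by (intro Suc.IH) auto
    qed
    ultimately show ?case
      using Suc.IH[of T] Suc.prems by simp
  qed
  have "int p dvd (\<Sum>A\<in>F. c A * P (p - 1) A)"
    using step[of "{}" "p - 1"] prime_gt_0_nat[OF p] by simp
  moreover have "int p dvd (\<Sum>A\<in>F - {B}. c A * P (p - 1) A)"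
  proof (intro dvd_sum dvd_mult)
    fix A assume A: "A \<in> F - {B}"
    define s where "s = card (A \<inter> B)"
    have "A \<inter> B \<noteq> B"
      using A F[of A] cB c(1) U by (metis DiffE Int_lower1 card_subset_eq finite_subset insertI1)
    then have "s < k"
      using BU cB by (metis psubsetI Int_lower2 psubset_card_mono s_def)
    moreover have "s \<noteq> t"
      using avoid[of A B] A c(1) by (auto simp: s_def)
    \<comment> \<open>Here \<open>s - t\<close> lies strictly between \<open>- p\<close> and
      \<open>p\<close> and is not 0, so its residue is one of 1, ..., p - 1 and kills a factor of
      \<open>P\<close>.\<close>
    ultimately have "\<exists>l\<in>{1..p-1}. int p dvd int s - int t - int l"
    proof (cases "s < t")
      case True
      then show ?thesis
        using \<open>t < p\<close> by (intro bexI[of _ "p + s - t"]) (auto simp: of_nat_diff)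
    next
      case False
      then show ?thesis
        using \<open>s < k\<close> \<open>s \<noteq> t\<close> k by (intro bexI[of _ "s - t"]) (auto simp: of_nat_diff)
    qed
    then show "int p dvd P (p - 1) A"
      unfolding P_def s_def by (meson dvd_prodI dvd_trans finite_atLeastAtMost)
  qed
  ultimately have "int p dvd c B * P (p - 1) B"
    using sum.remove[OF finF c(1), of "\<lambda>A. c A * P (p - 1) A"] by (simp add: dvd_add_left_iff)
  then have "int p dvd P (p - 1) B"
    using c(2) p by (simp add: prime_dvd_mult_iff)
  \<comment> \<open>At \<open>A = B\<close> the factors are \<open>k - t - l = p - l\<close>, none
    of which is divisible by \<open>p\<close>.\<close>
  then obtain l where l: "l \<in> {1..p-1}" "int p dvd int p - int l"
    using p cB k unfolding P_def by (auto simp: prime_dvd_prod_iff)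
  then have "int p dvd int l"
    by (metis dvd_diff_commute dvd_minus_iff dvd_refl dvd_diff_right_iff)
  then show False
    using l(1) prime_gt_0_nat[OF p] by (auto dest: dvd_imp_le)
qed

section \<open>Sets of size below p are a vanishing proportion\<close>

text \<open>For \<open>j < k - h\<close>, passing from level \<open>j + 1\<close> down to
  \<open>j\<close> multiplies the binomial by \<open>(j + 1) / (2 * k - j)\<close>, which is at most
  \<open>(k - h) / (k + h)\<close>. The powers record \<open>i\<close> such steps without
  division.\<close>

lemma central_binomial_decay:
  fixes k h i :: nat
  assumes "h + i \<le> k"
  shows "(k + h) ^ i * (2 * k choose (k - h - i)) \<le> (k - h) ^ i * (2 * k choose (k - h))"
  using assms
proof (induction i)
  case (Suc i)
  define j where "j = k - h - Suc i"
  have j: "k - h - i = Suc j" "k = j + Suc (h + i)"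
    using Suc.prems by (auto simp: j_def)
  have "(k + h) * (2 * k choose j) \<le> (2 * k - j) * (2 * k choose j)"
    using j by (intro mult_right_mono) auto
  also have "\<dots> = Suc j * (2 * k choose Suc j)"
    by (simp only: binomial_absorb_comp binomial_absorption)
  also have "\<dots> \<le> (k - h) * (2 * k choose Suc j)"
    using j by (intro mult_right_mono) auto
  finally have "(k + h) ^ i * ((k + h) * (2 * k choose j)) \<le> (k + h) ^ i * ((k - h) * (2 * k choose Suc j))"
    by (rule mult_left_mono) simp
  also have "\<dots> \<le> (k - h) * ((k - h) ^ i * (2 * k choose (k - h)))"
    using Suc.IH Suc.prems j(1) by (simp add: mult.left_commute)
  finally show ?case
    by (simp add: j_def mult_ac)
qed simp

text \<open>Decay is applied with \<open>h = u\<close>: every level below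
  \<open>p = k - 2 * u\<close> is at least \<open>u\<close> steps under level \<open>k - u\<close>,
  and each step costs the factor \<open>(k - u) / (k + u)\<close>. The factor \<open>p\<close>
  counts the levels.\<close>

lemma card_small_subsets_le:
  fixes k p u :: nat
  assumes k: "k = p + 2 * u" and p: "p > 0"
  shows "real (card {S. S \<subseteq> {..<2 * k} \<and> card S < p})
    \<le> real p * ((real p + real u) / (real p + 3 * real u)) ^ u * real (2 * k choose k)"
proof -
  define q where "q = (real p + real u) / (real p + 3 * real u)"
  have q: "0 < q" "q \<le> 1"
    using p by (auto simp: q_def divide_simps)
  have b: "real (2 * k choose j) \<le> q ^ u * real (2 * k choose k)" if "j < p" for j
  proof -
    define i where "i = k - u - j"
    have i: "k - u - i = j" "u + i \<le> k" "u \<le> i"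
      using that k by (auto simp: i_def)
    have "real ((k + u) ^ i * (2 * k choose j)) \<le> real ((k - u) ^ i * (2 * k choose (k - u)))"
      using central_binomial_decay[OF i(2)] unfolding i(1) of_nat_le_iff .
    then have "real (2 * k choose j) \<le> q ^ i * real (2 * k choose (k - u))"
      using p k by (simp add: q_def power_divide divide_simps mult_ac add_ac)
    also have "\<dots> \<le> q ^ u * real (2 * k choose k)"
    proof (rule mult_mono)
      show "real (2 * k choose (k - u)) \<le> real (2 * k choose k)"
        using binomial_maximum'[of k "k - u"] by simp
      show "q ^ i \<le> q ^ u"
        using q i(3) by (intro power_decreasing) auto
    qed (use q in auto)
    finally show ?thesis .
  qed
  have "{S. S \<subseteq> {..<2 * k} \<and> card S < p} = (\<Union>j<p. {S. S \<subseteq> {..<2 * k} \<and> card S = j})"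
    by auto
  then have "card {S. S \<subseteq> {..<2 * k} \<and> card S < p} \<le> (\<Sum>j<p. 2 * k choose j)"
    using card_UN_le[of "{..<p}" "\<lambda>j. {S. S \<subseteq> {..<2 * k} \<and> card S = j}"] by (simp add: n_subsets)
  then have "real (card {S. S \<subseteq> {..<2 * k} \<and> card S < p}) \<le> (\<Sum>j<p. real (2 * k choose j))"
    unfolding of_nat_sum[symmetric] of_nat_le_iff .
  also have "\<dots> \<le> (\<Sum>j<p. q ^ u * real (2 * k choose k))"
    by (intro sum_mono b) auto
  finally show ?thesis
    by (simp add: q_def mult_ac)
qed

text \<open>With \<open>t = 2 * u\<close> and \<open>u\<close> about \<open>p / (2 * N)\<close>, the
  ratio \<open>t / p\<close> is at most \<open>1 / N\<close>, yet \<open>u\<close> still grows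
  linearly in \<open>p\<close>, so the exponential decay in \<open>u\<close> beats the factor
  \<open>p\<close>.\<close>

lemma ex_prime_small_subsets_negligible:
  fixes \<eta> :: real
  assumes "\<eta> > 0"
  shows "\<exists>p t. prime p \<and> t < p \<and> real t / real p \<le> \<eta> \<and>
    real (card {S. S \<subseteq> {..<2 * (p + t)} \<and> card S < p}) < \<eta> * real (2 * (p + t) choose (p + t))"
proof -
  obtain N :: nat where N: "real N > max 2 (1 / \<eta>)"
    using reals_Archimedean2 by blast
  \<comment> \<open>An upper bound for \<open>(p + u) / (p + 3 * u)\<close> when
    \<open>p \<le> 4 * N * u\<close>; the inequality reduces to
    \<open>p + u \<le> 8 * N * u\<close>.\<close>
  define r where "r = 4 * real N / (4 * real N + 1)"
  have r: "0 < r" "r < 1"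
    using N by (auto simp: r_def)
  have "(\<lambda>n. real n * r ^ n) \<longlonglongrightarrow> 0"
    using powser_times_n_limit_0[of r] r by simp
  then have "\<forall>\<^sub>F n in sequentially. real n * r ^ n < \<eta> / (4 * real N)"
    using N assms by (intro order_tendstoD) auto
  then obtain u0 where u0: "\<And>n. n \<ge> u0 \<Longrightarrow> real n * r ^ n < \<eta> / (4 * real N)"
    by (auto simp: eventually_sequentially)
  \<comment> \<open>The extra 1 also forces \<open>u \<ge> 1\<close>, which is what bounds
    \<open>2 * N * (u + 1)\<close> by \<open>4 * N * u\<close>.\<close>
  obtain p where p: "prime p" "p > 2 * N * (u0 + 1)"
    using bigger_prime by blast
  define u where "u = p div (2 * N)"
  have N0: "N > 2"
    using N by linarith
  have "u0 + 1 \<le> u"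
    using p(2) N0 unfolding u_def by (simp add: less_eq_div_iff_mult_less_eq mult_ac)
  then have u: "u \<ge> u0" "u \<ge> 1"
    by auto
  have up: "2 * N * u \<le> p"
    by (simp add: u_def)
  have "p < 2 * N * (u + 1)"
    using N0 by (simp add: u_def dividend_less_times_div)
  also have "\<dots> \<le> 4 * N * u"
    using u(2) by simp
  finally have pu: "real p \<le> 4 * real N * real u"
    by (metis less_imp_le of_nat_le_iff of_nat_mult of_nat_numeral)
  have p0: "p > 0"
    using p by simp
  have upr: "2 * real N * real u \<le> real p"
    using up by (metis of_nat_le_iff of_nat_mult of_nat_numeral)
  have "real (2 * u) / real p \<le> 1 / real N"
    using upr p0 N0 by (simp add: divide_simps mult_ac)
  also have "\<dots> \<le> \<eta>"
    using N assms N0 by (simp add: divide_simps mult_ac split: if_splits)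
  finally have "real (2 * u) / real p \<le> \<eta>" .
  moreover have "2 * u < p"
  proof -
    have "2 * u < 2 * N * u"
      using N0 u by simp
    with up show ?thesis by linarith
  qed
  moreover have "real p * ((real p + real u) / (real p + 3 * real u)) ^ u < \<eta>"
  proof -
    have "(real p + real u) / (real p + 3 * real u) \<le> r"
    proof -
      have "real u * 1 \<le> real u * real N" using N0 by (intro mult_left_mono) auto
      then have "real p + real u \<le> 8 * real N * real u"
        using pu by (simp add: mult_ac)
      then show ?thesis
        using p0 N0 by (simp add: r_def divide_simps algebra_simps)
    qed
    then have "real p * ((real p + real u) / (real p + 3 * real u)) ^ u \<le> (4 * real N * real u) * r ^ u"
      using pu by (intro mult_mono power_mono) auto
    also have "\<dots> < \<eta>"
      using u0[OF u(1)] N0 by (simp add: field_simps)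
    finally show ?thesis .
  qed
  then have "real p * ((real p + real u) / (real p + 3 * real u)) ^ u * real (2 * (p + 2 * u) choose (p + 2 * u))
      < \<eta> * real (2 * (p + 2 * u) choose (p + 2 * u))"
    by (intro mult_strict_right_mono) auto
  with card_small_subsets_le[OF refl p0, of u]
  have "real (card {S. S \<subseteq> {..<2 * (p + 2 * u)} \<and> card S < p})
      < \<eta> * real (2 * (p + 2 * u) choose (p + 2 * u))"
    by (rule le_less_trans)
  ultimately show ?thesis
    using p(1) by blast
qed

section \<open>General bounds for distortion, the vector program and covers\<close>

lemma c1_le:
  assumes "D \<ge> 1" "embeds_l1 X d D"
  shows "c1 X d \<le> D"
  unfolding c1_def using assms by (intro cInf_lower) (auto intro: bdd_belowI[of _ 1])

lemma sqdist_eq_sum: "sqdist m x y = (\<Sum>l<m. (x l - y l)\<^sup>2)"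
  by (simp add: sqdist_def vnorm_def L2_set_def sum_nonneg)

lemma sqdist_unit_le_4:
  assumes "vnorm m x = 1" "vnorm m y = 1"
  shows "sqdist m x y \<le> 4"
proof -
  have "vnorm m (\<lambda>l. x l - y l) \<le> vnorm m x + vnorm m (\<lambda>l. - y l)"
    using L2_set_triangle_ineq[of x "\<lambda>l. - y l" "{..<m}"] by (simp add: vnorm_def)
  also have "vnorm m (\<lambda>l. - y l) = vnorm m y"
    by (simp add: vnorm_def L2_set_def)
  finally have "vnorm m (\<lambda>l. x l - y l) \<le> 2"
    using assms by simp
  then show ?thesis
    unfolding sqdist_def using power_mono[of _ "2::real" 2] by (simp add: vnorm_def)
qed

lemma sqdist_commute: "sqdist m x y = sqdist m y x"
  by (simp add: sqdist_eq_sum power2_commute)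

lemma sd_term_nonneg:
  assumes "sd_feasible \<delta> V E m v0 v" "i \<in> V"
  shows "0 \<le> 1 - sqdist m v0 (v i) / 4"
  using sqdist_unit_le_4[of m v0 "v i"] assms by (auto simp: sd_feasible_def)

lemma sd_le:
  assumes "sd_feasible \<delta> V E m v0 v"
  shows "sd \<delta> V E \<le> (\<Sum>i\<in>V. 1 - sqdist m v0 (v i) / 4)"
  unfolding sd_def
proof (rule cInf_lower)
  show "bdd_below {\<Sum>i\<in>V. 1 - sqdist m v0 (v i) / 4 |m v0 v. sd_feasible \<delta> V E m v0 v}"
    by (rule bdd_belowI[of _ 0]) (auto intro!: sum_nonneg sd_term_nonneg)
qed (use assms in blast)

text \<open>The ends of an edge have squared distances to \<open>v0\<close> adding up to a squared
  distance of unit vectors, hence to at most 4, so these two terms alone contribute 1. The feasible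
  point keeps the infimum from ranging over the empty set.\<close>

lemma sd_ge_1:
  assumes "finite V" "{i, j} \<in> E" "i \<noteq> j" "i \<in> V" "j \<in> V" and feas: "sd_feasible \<delta> V E m v0 v"
  shows "1 \<le> sd \<delta> V E"
  unfolding sd_def
proof (rule cInf_greatest)
  fix y assume "y \<in> {\<Sum>i\<in>V. 1 - sqdist m v0 (v i) / 4 |m v0 v. sd_feasible \<delta> V E m v0 v}"
  then obtain m v0 v where y: "y = (\<Sum>i\<in>V. 1 - sqdist m v0 (v i) / 4)" and f: "sd_feasible \<delta> V E m v0 v"
    by auto
  have "sqdist m (v i) v0 + sqdist m (v j) v0 = sqdist m (v i) (v j)" "sqdist m (v i) (v j) \<le> 4"
    using f assms sqdist_unit_le_4 by (auto simp: sd_feasible_def)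
  then have "1 \<le> (\<Sum>l\<in>{i, j}. 1 - sqdist m v0 (v l) / 4)"
    using assms(3) by (simp add: sqdist_commute)
  also have "\<dots> \<le> y"
    unfolding y using assms sd_term_nonneg[OF f] by (intro sum_mono2) auto
  finally show "1 \<le> y" .
qed (use feas in blast)

text \<open>The complement of a minimum cover is independent.\<close>

lemma vc_ge:
  assumes "finite_graph V E"
    and indep: "\<And>I. I \<subseteq> V \<Longrightarrow> (\<And>e. e \<in> E \<Longrightarrow> \<not> e \<subseteq> I) \<Longrightarrow> card I \<le> s"
  shows "card V \<le> vc V E + s"
proof -
  have V: "finite V" "E \<subseteq> nsets V 2"
    using assms(1) by (auto simp: finite_graph_def)
  let ?C = "{C. vertex_cover V E C}"
  have "finite ?C"
    by (rule finite_subset[of _ "Pow V"]) (use V in \<open>auto simp: vertex_cover_def\<close>)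
  moreover have "e \<inter> V \<noteq> {}" if "e \<in> E" for e
    using V(2) that by (auto simp: nsets_2_eq)
  then have "V \<in> ?C"
    by (auto simp: vertex_cover_def)
  ultimately have "vc V E \<in> card ` ?C"
    unfolding vc_def by (intro Min_in) auto
  then obtain C where C: "C \<subseteq> V" "\<And>e. e \<in> E \<Longrightarrow> e \<inter> C \<noteq> {}" "vc V E = card C"
    by (auto simp: vertex_cover_def)
  have "card (V - C) \<le> s"
    using C by (intro indep) auto
  then show ?thesis
    using C V by (simp add: card_Diff_subset finite_subset)
qed

section \<open>The cube configuration\<close>

definition apex_vec :: "nat \<Rightarrow> nat \<Rightarrow> real" where
  "apex_vec n = (\<lambda>l\<in>{..<Suc n}. if l < n then 0 else 1)"

text \<open>The square root is the scale at which these vectors have norm 1.\<close>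

definition cube_vec :: "nat \<Rightarrow> real \<Rightarrow> nat set \<Rightarrow> nat \<Rightarrow> real" where
  "cube_vec n \<xi> A = (\<lambda>l\<in>{..<Suc n}.
     if l < n then (if l \<in> A then 1 else - 1) * sqrt ((1 - \<xi>\<^sup>2) / real n) else \<xi>)"

context
  fixes n :: nat and \<xi> a :: real
  assumes n: "n > 0" and \<xi>: "0 \<le> \<xi>" "\<xi> < 1"
  defines "a \<equiv> sqrt ((1 - \<xi>\<^sup>2) / real n)"
begin

lemma a_pos: "a > 0" and a_sq: "real n * a\<^sup>2 = 1 - \<xi>\<^sup>2"
proof -
  have "\<xi>\<^sup>2 < 1"
    using \<xi> by (simp add: power_less_one_iff abs_square_less_1)
  then show "a > 0" "real n * a\<^sup>2 = 1 - \<xi>\<^sup>2"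
    using n by (auto simp: a_def)
qed

lemma cube_vec_nth: "l < n \<Longrightarrow> cube_vec n \<xi> A l = (if l \<in> A then a else - a)"
  by (simp add: cube_vec_def a_def)

lemma sqdist_apex_cube: "sqdist (Suc n) (apex_vec n) (cube_vec n \<xi> A) = 2 - 2 * \<xi>"
proof -
  have "(\<Sum>l<n. (apex_vec n l - cube_vec n \<xi> A l)\<^sup>2) = (\<Sum>l<n. a\<^sup>2)"
    by (rule sum.cong) (auto simp: apex_vec_def cube_vec_nth)
  then show ?thesis
    using a_sq by (simp add: sqdist_eq_sum apex_vec_def cube_vec_def power2_eq_square algebra_simps)
qed

text \<open>Each coordinate difference is 0 or \<open>2 * a\<close> in absolute value, so its square
  is \<open>2 * a\<close> times its absolute value.\<close>

lemma sqdist_cube_eq_l1: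
  "sqdist (Suc n) (cube_vec n \<xi> A) (cube_vec n \<xi> B) = 2 * a * l1_dist n (cube_vec n \<xi> A) (cube_vec n \<xi> B)"
proof -
  have "(\<Sum>l<n. (cube_vec n \<xi> A l - cube_vec n \<xi> B l)\<^sup>2)
      = (\<Sum>l<n. 2 * a * \<bar>cube_vec n \<xi> A l - cube_vec n \<xi> B l\<bar>)"
    using a_pos by (intro sum.cong) (auto simp: cube_vec_nth power2_eq_square)
  then show ?thesis
    by (simp add: sqdist_eq_sum l1_dist_def sum_distrib_left cube_vec_def)
qed

lemma sqdist_cube_cube:
  assumes "A \<subseteq> {..<n}" "B \<subseteq> {..<n}"
  shows "sqdist (Suc n) (cube_vec n \<xi> A) (cube_vec n \<xi> B) = 4 * a\<^sup>2 * real (card A + card B - 2 * card (A \<inter> B))"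
proof -
  have fin: "finite A" "finite B"
    using assms finite_subset by auto
  have "(\<Sum>l<n. (cube_vec n \<xi> A l - cube_vec n \<xi> B l)\<^sup>2)
      = (\<Sum>l<n. if l \<in> (A - B) \<union> (B - A) then 4 * a\<^sup>2 else 0)"
    by (rule sum.cong) (auto simp: cube_vec_nth power2_eq_square)
  also have "\<dots> = 4 * a\<^sup>2 * real (card ((A - B) \<union> (B - A)))"
    using assms by (subst sum.inter_restrict[symmetric]) (auto simp: Int_absorb1 Un_subset_iff subset_eq intro!: arg_cong[where f=card])
  also have "card ((A - B) \<union> (B - A)) = card (A - B) + card (B - A)"
    using fin by (intro card_Un_disjoint) auto
  also have "\<dots> = card A + card B - 2 * card (A \<inter> B)"
  proof -
    have "card A = card (A \<inter> B) + card (A - B)" "card B = card (A \<inter> B) + card (B - A)"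
      using fin card_Int_Diff[of A B] card_Int_Diff[of B A] by (auto simp: Int_commute)
    then show ?thesis by simp
  qed
  finally show ?thesis
    by (simp add: sqdist_eq_sum cube_vec_def)
qed

lemma vnorm_apex: "vnorm (Suc n) (apex_vec n) = 1"
  by (simp add: vnorm_def L2_set_def apex_vec_def)

lemma vnorm_cube: "vnorm (Suc n) (cube_vec n \<xi> A) = 1"
proof -
  have "(\<Sum>l<n. (cube_vec n \<xi> A l)\<^sup>2) = (\<Sum>l<n. a\<^sup>2)"
    by (rule sum.cong) (auto simp: cube_vec_nth)
  then show ?thesis
    using a_sq by (simp add: vnorm_def L2_set_def) (simp add: cube_vec_def)
qed

text \<open>Dropping the last coordinate scales distances exactly within the cube, while distances to
  the apex, which becomes the centre of the cube, are off by the factor \<open>1 + \<xi>\<close>.\<close>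

lemma c1_cube_le: "c1 (insert (apex_vec n) (cube_vec n \<xi> ` \<A>)) (sqdist (Suc n)) \<le> 1 + \<xi>"
proof (rule c1_le)
  let ?X = "insert (apex_vec n) (cube_vec n \<xi> ` \<A>)"
  have eq: "l1_dist n (restrict x {..<n}) (restrict y {..<n}) = l1_dist n x y" for x y :: "nat \<Rightarrow> real"
    by (simp add: l1_dist_def)
  have comm: "l1_dist n x y = l1_dist n y x" for x y
    by (simp add: l1_dist_def abs_minus_commute)
  have refl0: "l1_dist n x x = 0" "sqdist (Suc n) x x = 0" for x
    by (simp_all add: l1_dist_def sqdist_eq_sum)
  have cube: "l1_dist n (cube_vec n \<xi> A) (cube_vec n \<xi> B)
      = 1 / (2 * a) * sqdist (Suc n) (cube_vec n \<xi> A) (cube_vec n \<xi> B)" for A B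
    using sqdist_cube_eq_l1 a_pos by simp
  \<comment> \<open>The distance is \<open>n * a = (1 - \<xi>\<^sup>2) / a\<close>, and
    \<open>1 - \<xi>\<^sup>2\<close> is half of \<open>(1 + \<xi>) * (2 - 2 * \<xi>)\<close>: this
    is where the distortion arises.\<close>
  have apex: "l1_dist n (apex_vec n) (cube_vec n \<xi> A)
      = 1 / (2 * a) * (1 + \<xi>) * sqdist (Suc n) (apex_vec n) (cube_vec n \<xi> A)" for A
  proof -
    have "l1_dist n (apex_vec n) (cube_vec n \<xi> A) = (\<Sum>l<n. a)"
      unfolding l1_dist_def by (rule sum.cong) (use a_pos in \<open>auto simp: apex_vec_def cube_vec_nth\<close>)
    then show ?thesis
      using a_sq a_pos by (simp add: sqdist_apex_cube divide_simps power2_eq_square algebra_simps)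
  qed
  have apex': "l1_dist n (cube_vec n \<xi> A) (apex_vec n)
      = 1 / (2 * a) * (1 + \<xi>) * sqdist (Suc n) (cube_vec n \<xi> A) (apex_vec n)" for A
    using apex by (simp only: comm[of _ "apex_vec n"] sqdist_commute[of _ _ "apex_vec n"])
  have grow: "\<gamma> * d \<le> \<gamma> * (1 + \<xi>) * d" if "\<gamma> \<ge> 0" "d \<ge> 0" for \<gamma> d :: real
    using that \<xi> by (simp add: algebra_simps)
  have sq0: "sqdist (Suc n) x y \<ge> 0" for x y
    by (simp add: sqdist_def)
  have "1 / (2 * a) * sqdist (Suc n) x y \<le> l1_dist n x y \<and>
      l1_dist n x y \<le> 1 / (2 * a) * (1 + \<xi>) * sqdist (Suc n) x y" if "x \<in> ?X" "y \<in> ?X" for x y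
  proof -
    have g: "1 / (2 * a) * sqdist (Suc n) x y \<le> 1 / (2 * a) * (1 + \<xi>) * sqdist (Suc n) x y"
      using a_pos by (intro grow sq0) simp
    have "l1_dist n x y = 1 / (2 * a) * sqdist (Suc n) x y
        \<or> l1_dist n x y = 1 / (2 * a) * (1 + \<xi>) * sqdist (Suc n) x y"
      using that cube apex apex' refl0 by (elim insertE imageE) simp_all
    with g show ?thesis by linarith
  qed
  then show "embeds_l1 ?X (sqdist (Suc n)) (1 + \<xi>)"
    unfolding embeds_l1_def
    by (intro exI[of _ n] exI[of _ "\<lambda>x. restrict x {..<n}"] exI[of _ "1 / (2 * a)"] conjI)
      (use a_pos in \<open>auto simp: eq Rvec_def\<close>)
qed (use \<xi> in simp)

end

text \<open>Adjacent sets differ in \<open>2 * p\<close> points, and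
  \<open>k = p * (1 + \<xi>)\<close> makes their squared distance \<open>4 - 4 * \<xi>\<close>,
  twice the squared distance to the apex.\<close>

lemma cube_feasible:
  fixes p t k :: nat
  assumes k: "k = p + t" and t: "t < p" and \<xi>: "\<xi> = real t / real p" "\<xi> \<le> \<delta>"
    and V: "\<And>i. i \<in> V \<Longrightarrow> h i \<subseteq> {..<2 * k} \<and> card (h i) = k"
    and E: "\<And>i j. {i, j} \<in> E \<Longrightarrow> i \<in> V \<and> j \<in> V \<and> card (h i \<inter> h j) = t"
  shows "sd_feasible \<delta> V E (Suc (2 * k)) (apex_vec (2 * k)) (\<lambda>i. cube_vec (2 * k) \<xi> (h i))"
proof -
  have n: "2 * k > 0" and x: "0 \<le> \<xi>" "\<xi> < 1"
    unfolding \<xi>(1) using t k by auto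
  note facts = sqdist_apex_cube[OF n x] sqdist_cube_cube[OF n x] vnorm_apex[OF n x] vnorm_cube[OF n x]
  have "sqdist (Suc (2 * k)) (cube_vec (2 * k) \<xi> (h i)) (cube_vec (2 * k) \<xi> (h j)) = 4 - 4 * \<xi>"
    if "{i, j} \<in> E" for i j
  proof -
    have "i \<in> V" "j \<in> V" "card (h i \<inter> h j) = t"
      using E that by auto
    moreover have "k + k - 2 * t = 2 * p"
      using k by simp
    ultimately have "sqdist (Suc (2 * k)) (cube_vec (2 * k) \<xi> (h i)) (cube_vec (2 * k) \<xi> (h j))
        = 4 * ((1 - \<xi>\<^sup>2) / real (2 * k)) * real (2 * p)"
      using V a_pos[OF n x] by (simp add: facts(2) real_sqrt_pow2)
    moreover have "real k = real p * (1 + \<xi>)"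
      using k t \<xi> by (simp add: algebra_simps)
    moreover have "1 - \<xi>\<^sup>2 = (1 - \<xi>) * (1 + \<xi>)"
      by (simp add: algebra_simps power2_eq_square)
    ultimately show ?thesis
      using t x by simp
  qed
  moreover have sqdist_cube_apex:
      "sqdist (Suc (2 * k)) (cube_vec (2 * k) \<xi> A) (apex_vec (2 * k)) = 2 - 2 * \<xi>" for A
    by (subst sqdist_commute) (rule facts)
  moreover have "c1 (insert (apex_vec (2 * k)) ((\<lambda>i. cube_vec (2 * k) \<xi> (h i)) ` V)) (sqdist (Suc (2 * k))) \<le> 1 + \<delta>"
    using c1_cube_le[OF n x, of "h ` V"] \<xi>(2) by (simp add: image_image)
  moreover have "apex_vec (2 * k) \<in> Rvec (Suc (2 * k))" "cube_vec (2 * k) \<xi> A \<in> Rvec (Suc (2 * k))" for A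
    by (auto simp: Rvec_def apex_vec_def cube_vec_def)
  ultimately show ?thesis
    unfolding sd_feasible_def
    by (auto simp: facts sqdist_cube_apex)
qed

section \<open>The graph and the final ratio\<close>

theorem theorem3:
  fixes \<delta> \<epsilon> :: real
  assumes "\<delta> > 0" and "\<epsilon> > 0"
  shows "\<exists>(V :: nat set) E. finite_graph V E \<and> sd \<delta> V E > 0 \<and>
           real (vc V E) / sd \<delta> V E \<ge> 2 - \<epsilon>"
proof -
  \<comment> \<open>\<open>\<delta>\<close> bounds the distortion, \<open>\<epsilon> / 4\<close>
    serves the final ratio, and 1 makes \<open>s < n\<close>, so that the graph has an edge.\<close>
  define \<eta> where "\<eta> = Min {\<delta>, \<epsilon> / 4, 1}"
  have \<eta>: "\<eta> > 0" "\<eta> \<le> \<delta>" "\<eta> \<le> \<epsilon> / 4" "\<eta> \<le> 1"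
    unfolding \<eta>_def using assms by simp_all
  obtain p t where pt: "prime p" "t < p" "real t / real p \<le> \<eta>"
    and small: "real (card {S. S \<subseteq> {..<2 * (p + t)} \<and> card S < p}) < \<eta> * real (2 * (p + t) choose (p + t))"
    using ex_prime_small_subsets_negligible[OF \<eta>(1)] by blast
  define k where "k = p + t"
  define s where "s = card {S. S \<subseteq> {..<2 * k} \<and> card S < p}"
  define n where "n = 2 * k choose k"
  define \<xi> where "\<xi> = real t / real p"
  have "card {A. A \<subseteq> {..<2 * k} \<and> card A = k} = n"
    by (simp add: n_subsets n_def)
  moreover have "finite {A. A \<subseteq> {..<2 * k} \<and> card A = k}"
    by simp
  \<comment> \<open>Vertices must be natural numbers, so the \<open>k\<close>-subsets are numbered
    by \<open>h\<close>.\<close>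
  ultimately have "\<exists>h. bij_betw h {..<n} {A. A \<subseteq> {..<2 * k} \<and> card A = k}"
    by (metis ex_bij_betw_nat_finite atLeast0LessThan)
  then obtain h where h: "bij_betw h {..<n} {A. A \<subseteq> {..<2 * k} \<and> card A = k}" ..
  define V where "V = {..<n}"
  define E where "E = {{i, j} | i j. i \<in> V \<and> j \<in> V \<and> card (h i \<inter> h j) = t}"
  have hV: "h i \<subseteq> {..<2 * k} \<and> card (h i) = k" if "i \<in> V" for i
    using bij_betw_apply[OF h] that by (auto simp: V_def)
  have neq: "i \<noteq> j" if "i \<in> V" "card (h i \<inter> h j) = t" for i j
  proof
    assume "i = j"
    then have "k = t"
      using hV[OF that(1)] that(2) by simp
    then show False
      using pt(2) by (simp add: k_def)
  qed
  have E: "i \<in> V \<and> j \<in> V \<and> card (h i \<inter> h j) = t" if "{i, j} \<in> E" for i j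
  proof -
    obtain i' j' where "{i, j} = {i', j'}" "i' \<in> V" "j' \<in> V" "card (h i' \<inter> h j') = t"
      using \<open>{i, j} \<in> E\<close> unfolding E_def by blast
    then show ?thesis
      by (auto simp: doubleton_eq_iff Int_commute)
  qed
  have graph: "finite_graph V E"
  proof -
    have "{i, j} \<in> nsets V 2" if "i \<in> V" "j \<in> V" "card (h i \<inter> h j) = t" for i j
      using that neq[OF that(1,3)] by (simp add: doubleton_in_nsets_2)
    moreover have "finite V"
      by (simp add: V_def)
    ultimately show ?thesis
      unfolding finite_graph_def E_def by blast
  qed
  have indep: "card I \<le> s" if "I \<subseteq> V" "\<And>e. e \<in> E \<Longrightarrow> \<not> e \<subseteq> I" for I
  proof -
    have "card (h ` I) \<le> s"
      unfolding s_def
    proof (rule frankl_wilson[OF pt(1,2) k_def])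
      show "A \<subseteq> {..<2 * k} \<and> card A = k" if "A \<in> h ` I" for A
        using that hV \<open>I \<subseteq> V\<close> by auto
      show "card (A \<inter> B) \<noteq> t" if AB: "A \<in> h ` I" "B \<in> h ` I" for A B
      proof
        assume "card (A \<inter> B) = t"
        then obtain i j where "i \<in> I" "j \<in> I" "card (h i \<inter> h j) = t"
          using AB by auto
        then show False
          using \<open>I \<subseteq> V\<close> \<open>\<And>e. e \<in> E \<Longrightarrow> \<not> e \<subseteq> I\<close>[of "{i, j}"] by (auto simp: E_def)
      qed
    qed simp
    moreover have "inj_on h I"
      using inj_on_subset[OF bij_betw_imp_inj_on[OF h]] that(1) by (simp add: V_def)
    ultimately show ?thesis
      by (simp add: card_image)
  qed
  have cV: "card V = n"
    by (simp add: V_def)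
  have sn: "real s < \<eta> * real n"
    using small by (simp add: s_def n_def k_def)
  have feas: "sd_feasible \<delta> V E (Suc (2 * k)) (apex_vec (2 * k)) (\<lambda>i. cube_vec (2 * k) \<xi> (h i))"
  proof (rule cube_feasible[OF k_def pt(2) \<xi>_def _ hV E])
    show "\<xi> \<le> \<delta>"
      using pt(3) \<eta>(2) by (simp add: \<xi>_def)
  qed
  \<comment> \<open>Without edges all of \<open>V\<close> would be independent. An edge is what
    makes \<open>sd\<close> at least 1, so that dividing by it is legitimate.\<close>
  have "E \<noteq> {}"
  proof
    assume "E = {}"
    then have "n \<le> s"
      using indep[of V] cV by simp
    moreover have "\<eta> * real n \<le> real n"
      using \<eta>(1,4) by (intro mult_left_le_one_le) auto
    ultimately show False
      using sn by linarith
  qed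
  then obtain i j where ij: "{i, j} \<in> E"
    by (auto simp: E_def)
  have "i \<noteq> j" "i \<in> V" "j \<in> V"
    using E[OF ij] neq by blast+
  then have sd1: "1 \<le> sd \<delta> V E"
    using sd_ge_1[OF _ ij _ _ _ feas] by (simp add: V_def)
  have x: "0 \<le> \<xi>" "\<xi> < 1" "\<xi> \<le> \<eta>"
    using pt by (auto simp: \<xi>_def divide_simps)
  have "2 * k > 0"
    using pt(2) by (simp add: k_def)
  note apex = sqdist_apex_cube[OF this x(1,2)]
  have "sd \<delta> V E \<le> real n * (1 - (2 - 2 * \<xi>) / 4)"
    using sd_le[OF feas] unfolding apex sum_constant cV .
  also have "\<dots> = real n * (1 + \<xi>) / 2"
    by (simp add: field_simps)
  also have "\<dots> \<le> real n * (1 + \<eta>) / 2"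
    using x(3) by (intro divide_right_mono mult_left_mono) auto
  finally have sd2: "sd \<delta> V E \<le> real n * (1 + \<eta>) / 2" .
  have vc: "real n * (1 - \<eta>) \<le> real (vc V E)"
  proof -
    have "n \<le> vc V E + s"
      using vc_ge[OF graph indep] cV by simp
    then have "real n \<le> real (vc V E) + real s"
      unfolding of_nat_add[symmetric] of_nat_le_iff .
    then show ?thesis
      using sn by (simp add: right_diff_distrib mult.commute)
  qed
  have "(2 - \<epsilon>) * sd \<delta> V E \<le> real (vc V E)"
  \<comment> \<open>For \<open>\<epsilon> \<ge> 2\<close> the left side is not positive; otherwise
    \<open>4 * \<eta> \<le> \<epsilon>\<close> and
    \<open>(1 - 2 * \<eta>) * (1 + \<eta>) \<le> 1 - \<eta>\<close> suffice.\<close>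
  proof (cases "\<epsilon> \<ge> 2")
    case True
    then show ?thesis
      using sd1 by (intro order.trans[OF mult_nonpos_nonneg]) auto
  next
    case False
    have "(2 - \<epsilon>) * sd \<delta> V E \<le> (2 - 4 * \<eta>) * (real n * (1 + \<eta>) / 2)"
      using False sd1 sd2 \<eta> by (intro mult_mono) auto
    also have "\<dots> = real n * ((1 - 2 * \<eta>) * (1 + \<eta>))"
      by (simp add: field_simps)
    also have "\<dots> \<le> real n * (1 - \<eta>)"
      using \<eta>(1) by (intro mult_left_mono) (auto simp: algebra_simps)
    finally show ?thesis
      using vc by linarith
  qed
  then have "real (vc V E) / sd \<delta> V E \<ge> 2 - \<epsilon>"
    using sd1 by (simp add: pos_le_divide_eq)
  with graph sd1 show ?thesis
    by (intro exI[of _ V] exI[of _ E]) auto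
qed

end
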